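(* Let $$\kappa(x,y) := (x^{*} \lor y^{**})^{**} \land [(x \lor x^{*})^{+} \lor x^{*} \lor y \lor y^{*}],\qquad \kappa^d(x,y) := (x^{+} \land y^{++})^{++} \lor [(x \land x^{+})^{*} \land x^{+} \land y \land y^{+}].$$ (a) If $\mathbf A = \langle A, \vee, \wedge, \to, {}^+, 0, 1 \rangle \in \mathbb{RDPCH}$ is a regular dually pseudocomplemented Heyting algebra (with $x^* := x\to 0$), then $\mathbf A \models x \to y \approx \kappa(x,y)$. (b) If $\mathbf A = \langle A, \vee, \wedge, {}^*, \leftarrow, 0, 1 \rangle \in \mathbb{RPCH}^d$ is a regular pseudocomplemented dual Heyting algebra (with $x^+ := x\leftarrow 1$), then $\mathbf A \models x \leftarrow y \approx \kappa^d(x,y)$. (c) If $\mathbf A = \langle A, \vee, \wedge, \to, \leftarrow, 0, 1 \rangle \in \mathbb{RDBLH}$ is a regular double Heyting algebra (with $x^* := x\to 0$ and $x^+ := x\leftarrow 1$), then (i) $\mathbf A \models x \to y \approx \kappa(x,y)$ and (ii) $\mathbf A \models x \leftarrow y \approx \kappa^d(x,y)$.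
   Context: A (distributive) p-algebra is a bounded distributive lattice with a unary operation ${}^*$ such that $x^*$ is the largest $z$ with $x\wedge z=0$. A dual p-algebra is a bounded distributive lattice with a unary operation ${}^+$ such that $x^+$ is the least $z$ with $x\vee z=1$. In a Heyting algebra $x\to y$ is the largest $z$ with $x\wedge z\le y$; in a dual Heyting algebra $x\leftarrow y$ is the least $z$ with $y\le x\vee z$. $\mathbb{RDPCH}$ (regular dually pseudocomplemented Heyting algebras): algebras $\langle A,\vee,\wedge,\to,{}^+,0,1\rangle$ such that $\langle A,\vee,\wedge,\to,0,1\rangle$ is a Heyting algebra, $\langle A,\vee,\wedge,{}^+,0,1\rangle$ is a dual p-algebra, and, with $x^*:=x\to 0$, the regularity identity $(x\wedge x^+)\vee(y\vee y^* )\approx y\vee y^*$ (i.e. $x\wedge x^+\le y\vee y^*$) holds. $\mathbb{RPCH}^d$ (regular pseudocomplemented dual Heyting algebras): algebras $\langle A,\vee,\wedge,{}^*,\leftarrow,0,1\rangle$ that are order-duals of members of $\mathbb{RDPCH}$, i.e. the $\vee,\wedge,{}^*,0,1$-reduct is a p-algebra, the $\vee,\wedge,\leftarrow,0,1$-reduct is a dual Heyting algebra, and, with $x^+:=x\leftarrow 1$, the same regularity identity holds. $\mathbb{RDBLH}$ (regular double Heyting algebras): algebras $\langle A,\vee,\wedge,\to,\leftarrow,0,1\rangle$ that are both Heyting algebras (via $\to$) and dual Heyting algebras (via $\leftarrow$) and satisfy the regularity identity with $x^*:=x\to0$, $x^+:=x\leftarrow1$. *)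

theory Defs
  imports Main
begin

text \<open>
  An algebra is given by explicit operations, and its carrier is the whole type \<open>'a\<close>. As in the
  library's lattice classes the parameters include the order, which the lattice axioms determine
  from meet and join. Nothing excludes the one-element algebra.
\<close>

locale bounded_distrib_lattice =
  bounded_lattice inf less_eq less sup bot top + distrib_lattice inf less_eq less sup
  for inf :: "'a \<Rightarrow> 'a \<Rightarrow> 'a" (infixl \<open>\<sqinter>\<close> 70)
    and less_eq :: "'a \<Rightarrow> 'a \<Rightarrow> bool" (infix \<open>\<sqsubseteq>\<close> 50)
    and less :: "'a \<Rightarrow> 'a \<Rightarrow> bool" (infix \<open>\<sqsubset>\<close> 50)
    and sup :: "'a \<Rightarrow> 'a \<Rightarrow> 'a" (infixl \<open>\<squnion>\<close> 65)
    and bot :: 'a (\<open>\<bottom>\<close>)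
    and top :: 'a (\<open>\<top>\<close>)

locale p_algebra = bounded_distrib_lattice +
  fixes star :: "'a \<Rightarrow> 'a" (\<open>_\<^sup>\<star>\<close> [1000] 1000)
  assumes inf_star: "x \<sqinter> x\<^sup>\<star> = \<bottom>"
    and star_greatest: "x \<sqinter> z = \<bottom> \<Longrightarrow> z \<sqsubseteq> x\<^sup>\<star>"

locale dual_p_algebra = bounded_distrib_lattice +
  fixes plus :: "'a \<Rightarrow> 'a" (\<open>_\<^sup>\<oplus>\<close> [1000] 1000)
  assumes sup_plus: "x \<squnion> x\<^sup>\<oplus> = \<top>"
    and plus_least: "x \<squnion> z = \<top> \<Longrightarrow> x\<^sup>\<oplus> \<sqsubseteq> z"

locale heyting_algebra = bounded_distrib_lattice +
  fixes imp :: "'a \<Rightarrow> 'a \<Rightarrow> 'a" (infixr \<open>\<rightarrow>\<close> 60)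
  assumes inf_imp: "x \<sqinter> (x \<rightarrow> y) \<sqsubseteq> y"
    and imp_greatest: "x \<sqinter> z \<sqsubseteq> y \<Longrightarrow> z \<sqsubseteq> x \<rightarrow> y"

text \<open>Note the order of arguments: \<open>x \<leftarrow> y\<close> is the least \<open>z\<close> with \<open>y \<sqsubseteq> x \<squnion> z\<close>.\<close>

locale dual_heyting_algebra = bounded_distrib_lattice +
  fixes coimp :: "'a \<Rightarrow> 'a \<Rightarrow> 'a" (infixr \<open>\<leftarrow>\<close> 60)
  assumes sup_coimp: "y \<sqsubseteq> x \<squnion> (x \<leftarrow> y)"
    and coimp_least: "y \<sqsubseteq> x \<squnion> z \<Longrightarrow> x \<leftarrow> y \<sqsubseteq> z"

context
  fixes inf :: "'a \<Rightarrow> 'a \<Rightarrow> 'a" (infixl \<open>\<sqinter>\<close> 70)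
    and sup :: "'a \<Rightarrow> 'a \<Rightarrow> 'a" (infixl \<open>\<squnion>\<close> 65)
    and star :: "'a \<Rightarrow> 'a" (\<open>_\<^sup>\<star>\<close> [1000] 1000)
    and plus :: "'a \<Rightarrow> 'a" (\<open>_\<^sup>\<oplus>\<close> [1000] 1000)
begin

definition regular :: bool where
  "regular \<longleftrightarrow> (\<forall>x y. (x \<sqinter> x\<^sup>\<oplus>) \<squnion> (y \<squnion> y\<^sup>\<star>) = y \<squnion> y\<^sup>\<star>)"

definition kappa :: "'a \<Rightarrow> 'a \<Rightarrow> 'a" where
  "kappa x y = (x\<^sup>\<star> \<squnion> y\<^sup>\<star>\<^sup>\<star>)\<^sup>\<star>\<^sup>\<star> \<sqinter> ((x \<squnion> x\<^sup>\<star>)\<^sup>\<oplus> \<squnion> x\<^sup>\<star> \<squnion> y \<squnion> y\<^sup>\<star>)"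

definition kappa_d :: "'a \<Rightarrow> 'a \<Rightarrow> 'a" where
  "kappa_d x y = (x\<^sup>\<oplus> \<sqinter> y\<^sup>\<oplus>\<^sup>\<oplus>)\<^sup>\<oplus>\<^sup>\<oplus> \<squnion> ((x \<sqinter> x\<^sup>\<oplus>)\<^sup>\<star> \<sqinter> x\<^sup>\<oplus> \<sqinter> y \<sqinter> y\<^sup>\<oplus>)"

end

locale RDPCH =
  heyting_algebra inf less_eq less sup bot top imp +
  dual_p_algebra inf less_eq less sup bot top plus
  for inf :: "'a \<Rightarrow> 'a \<Rightarrow> 'a" and less_eq less sup bot top imp plus +
  assumes regularity: "regular inf sup (\<lambda>x. imp x bot) plus"

locale RPCHd =
  p_algebra inf less_eq less sup bot top star +
  dual_heyting_algebra inf less_eq less sup bot top coimp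
  for inf :: "'a \<Rightarrow> 'a \<Rightarrow> 'a" and less_eq less sup bot top star coimp +
  assumes regularity: "regular inf sup star (\<lambda>x. coimp x top)"

locale RDBLH =
  heyting_algebra inf less_eq less sup bot top imp +
  dual_heyting_algebra inf less_eq less sup bot top coimp
  for inf :: "'a \<Rightarrow> 'a \<Rightarrow> 'a" and less_eq less sup bot top imp coimp +
  assumes regularity: "regular inf sup (\<lambda>x. imp x bot) (\<lambda>x. coimp x top)"

end

theory Submission
  imports Defs
begin

text \<open>
  Regularity enters only once: for \<open>w = x \<squnion> x\<^sup>\<star>\<close> it bounds \<open>w \<sqinter> w\<^sup>\<oplus>\<close> by \<open>y \<squnion> y\<^sup>\<star>\<close>, so the second
  factor of \<open>\<kappa>(x, y)\<close> puts \<open>x \<sqinter> \<kappa>(x, y)\<close> below \<open>y \<squnion> y\<^sup>\<star>\<close>, while the first factor makes it disjoint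
  from \<open>y\<^sup>\<star>\<close>. Hence \<open>\<kappa>(x, y)\<close> satisfies the adjunction that characterises \<open>x \<rightarrow> y\<close>. The notion of a
  regular double p-algebra is self-dual, and duality gives the statement for \<open>\<leftarrow>\<close>.
\<close>

context p_algebra
begin

lemma le_star_iff: "z \<sqsubseteq> x\<^sup>\<star> \<longleftrightarrow> x \<sqinter> z = \<bottom>"
proof
  assume "z \<sqsubseteq> x\<^sup>\<star>"
  then have "x \<sqinter> z \<sqsubseteq> x \<sqinter> x\<^sup>\<star>" by (intro inf_mono order_refl)
  then show "x \<sqinter> z = \<bottom>" by (simp add: inf_star bot_unique)
qed (rule star_greatest)

text \<open>Every element lies below its double pseudocomplement. At \<open>x\<^sup>\<star>\<close>
  this gives one inequality; for \<open>x\<close> itself it shows that whatever is disjoint from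
  \<open>x\<^sup>\<star>\<^sup>\<star>\<close> is disjoint from \<open>x\<close>, which gives the
  other.\<close>

lemma star_star_star: "x\<^sup>\<star>\<^sup>\<star>\<^sup>\<star> = x\<^sup>\<star>"
proof (rule order.antisym)
  have "x\<^sup>\<star>\<^sup>\<star> \<sqinter> x\<^sup>\<star>\<^sup>\<star>\<^sup>\<star> = \<bottom>" by (rule inf_star)
  moreover have "x \<sqsubseteq> x\<^sup>\<star>\<^sup>\<star>" by (metis le_star_iff inf_star inf.commute)
  ultimately show "x\<^sup>\<star>\<^sup>\<star>\<^sup>\<star> \<sqsubseteq> x\<^sup>\<star>" by (metis le_star_iff inf_mono order_refl bot_unique)
  show "x\<^sup>\<star> \<sqsubseteq> x\<^sup>\<star>\<^sup>\<star>\<^sup>\<star>" by (metis le_star_iff inf_star inf.commute)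
qed

lemma star_sup: "(x \<squnion> y)\<^sup>\<star> = x\<^sup>\<star> \<sqinter> y\<^sup>\<star>"
proof -
  have "z \<sqsubseteq> (x \<squnion> y)\<^sup>\<star> \<longleftrightarrow> z \<sqsubseteq> x\<^sup>\<star> \<sqinter> y\<^sup>\<star>" for z
    by (simp add: le_star_iff inf_sup_distrib2)
  then show ?thesis by (metis order.antisym order_refl)
qed

lemma le_star_star_iff: "z \<sqsubseteq> x\<^sup>\<star>\<^sup>\<star> \<longleftrightarrow> z \<sqinter> x\<^sup>\<star> = \<bottom>"
  by (simp add: le_star_iff inf.commute)

end

text \<open>The structure shared by all three classes. Since \<open>kappa\<close> and
  \<open>kappa_d\<close> mention only \<open>star\<close> and \<open>plus\<close>, their adjunctions
  can be proved here once, before any residual operation is present.\<close>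

locale regular_double_p_algebra =
  p_algebra inf less_eq less sup bot top star +
  dual_p_algebra inf less_eq less sup bot top plus
  for inf :: "'a \<Rightarrow> 'a \<Rightarrow> 'a" (infixl \<open>\<sqinter>\<close> 70)
    and less_eq (infix \<open>\<sqsubseteq>\<close> 50)
    and less (infix \<open>\<sqsubset>\<close> 50)
    and sup (infixl \<open>\<squnion>\<close> 65)
    and bot (\<open>\<bottom>\<close>)
    and top (\<open>\<top>\<close>)
    and star (\<open>_\<^sup>\<star>\<close> [1000] 1000)
    and plus (\<open>_\<^sup>\<oplus>\<close> [1000] 1000) +
  assumes regularity: "regular inf sup star plus"
begin

lemma inf_plus_le_sup_star: "x \<sqinter> x\<^sup>\<oplus> \<sqsubseteq> y \<squnion> y\<^sup>\<star>"
  using regularity by (simp add: regular_def le_iff_sup)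

lemma le_kappa_iff: "z \<sqsubseteq> kappa inf sup star plus x y \<longleftrightarrow> x \<sqinter> z \<sqsubseteq> y"
proof
  define w where "w = x \<squnion> x\<^sup>\<star>"
  \<comment> \<open>By De Morgan for joins and the collapse of triple stars, the first factor is the
    pseudocomplement of \<open>x\<^sup>\<star>\<^sup>\<star> \<sqinter> y\<^sup>\<star>\<close>, so
    lying below it is a disjointness condition.\<close>
  have kappa: "z \<sqsubseteq> kappa inf sup star plus x y \<longleftrightarrow>
      z \<sqinter> (x\<^sup>\<star>\<^sup>\<star> \<sqinter> y\<^sup>\<star>) = \<bottom> \<and> z \<sqsubseteq> w\<^sup>\<oplus> \<squnion> x\<^sup>\<star> \<squnion> y \<squnion> y\<^sup>\<star>"
    by (simp add: kappa_def w_def le_star_iff star_sup star_star_star inf.commute)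
  {
    assume xz: "x \<sqinter> z \<sqsubseteq> y"
    have "x \<sqinter> z \<sqinter> y\<^sup>\<star> \<sqsubseteq> y \<sqinter> y\<^sup>\<star>" using xz by (intro inf_mono order_refl)
    then have "z \<sqinter> y\<^sup>\<star> \<sqsubseteq> x\<^sup>\<star>" by (simp add: le_star_iff inf_star bot_unique inf.assoc)
    then have "z \<sqinter> y\<^sup>\<star> \<sqinter> x\<^sup>\<star>\<^sup>\<star> \<sqsubseteq> x\<^sup>\<star> \<sqinter> x\<^sup>\<star>\<^sup>\<star>" by (intro inf_mono order_refl)
    then have 1: "z \<sqinter> (x\<^sup>\<star>\<^sup>\<star> \<sqinter> y\<^sup>\<star>) = \<bottom>" by (simp add: inf_star bot_unique inf.commute inf.left_commute)
    \<comment> \<open>Splitting \<open>z\<close> along the cover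
      \<open>w \<squnion> w\<^sup>\<oplus> = \<top>\<close> gives three pieces, each below one
      joinand of the second factor.\<close>
    have "z = z \<sqinter> (w \<squnion> w\<^sup>\<oplus>)" by (simp add: sup_plus)
    also have "\<dots> = x \<sqinter> z \<squnion> z \<sqinter> x\<^sup>\<star> \<squnion> z \<sqinter> w\<^sup>\<oplus>"
      by (simp add: w_def inf_sup_distrib1 inf.commute)
    also have "\<dots> \<sqsubseteq> y \<squnion> x\<^sup>\<star> \<squnion> w\<^sup>\<oplus>" using xz by (intro sup_mono inf_le2)
    also have "\<dots> \<sqsubseteq> w\<^sup>\<oplus> \<squnion> x\<^sup>\<star> \<squnion> y \<squnion> y\<^sup>\<star>" by (simp add: le_supI1 le_supI2)
    finally show "z \<sqsubseteq> kappa inf sup star plus x y" using 1 kappa by simp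
  next
    assume "z \<sqsubseteq> kappa inf sup star plus x y"
    then have 1: "z \<sqinter> (x\<^sup>\<star>\<^sup>\<star> \<sqinter> y\<^sup>\<star>) = \<bottom>" and 2: "z \<sqsubseteq> w\<^sup>\<oplus> \<squnion> x\<^sup>\<star> \<squnion> y \<squnion> y\<^sup>\<star>"
      using kappa by simp_all
    have "x \<sqsubseteq> x\<^sup>\<star>\<^sup>\<star>" by (simp add: le_star_star_iff inf_star)
    then have "z \<sqinter> (x \<sqinter> y\<^sup>\<star>) \<sqsubseteq> z \<sqinter> (x\<^sup>\<star>\<^sup>\<star> \<sqinter> y\<^sup>\<star>)" by (intro inf_mono order_refl)
    then have disjoint: "x \<sqinter> z \<sqinter> y\<^sup>\<star> = \<bottom>"
      unfolding 1 bot_unique by (simp add: inf.commute inf.left_commute)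
    have "x \<sqinter> w\<^sup>\<oplus> \<sqsubseteq> w \<sqinter> w\<^sup>\<oplus>" by (simp add: w_def le_infI1)
    then have xw: "x \<sqinter> w\<^sup>\<oplus> \<sqsubseteq> y \<squnion> y\<^sup>\<star>" using inf_plus_le_sup_star order.trans by blast
    have "x \<sqinter> z \<sqsubseteq> x \<sqinter> (w\<^sup>\<oplus> \<squnion> x\<^sup>\<star> \<squnion> y \<squnion> y\<^sup>\<star>)" using 2 by (intro inf_mono order_refl)
    also have "\<dots> \<sqsubseteq> y \<squnion> y\<^sup>\<star>"
      using xw by (simp add: inf_sup_distrib1 inf_star le_infI2)
    \<comment> \<open>Distributing over \<open>y \<squnion> y\<^sup>\<star>\<close> leaves only the
      \<open>y\<close> part, because \<open>disjoint\<close> kills the other.\<close>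
    finally have "x \<sqinter> z = x \<sqinter> z \<sqinter> (y \<squnion> y\<^sup>\<star>)" by (simp add: inf.absorb1)
    also have "\<dots> = x \<sqinter> z \<sqinter> y" by (simp add: inf_sup_distrib1 disjoint)
    finally show "x \<sqinter> z \<sqsubseteq> y" by (metis inf_le2)
  }
qed

text \<open>Reversing the order swaps \<open>star\<close> with \<open>plus\<close> and turns
  regularity into the same inequality with the two variables exchanged.\<close>

lemma dual_regular_double_p_algebra:
  "regular_double_p_algebra sup (\<lambda>x y. y \<sqsubseteq> x) (\<lambda>x y. y \<sqsubset> x) inf top bot plus star"
proof -
  interpret dual: bounded_lattice sup "\<lambda>x y. y \<sqsubseteq> x" "\<lambda>x y. y \<sqsubset> x" inf top bot
    by (rule dual_bounded_lattice)
  interpret dual: distrib_lattice sup "\<lambda>x y. y \<sqsubseteq> x" "\<lambda>x y. y \<sqsubset> x" inf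
    by (rule dual_distrib_lattice)
  have "regular sup inf plus star"
    using inf_plus_le_sup_star by (simp add: regular_def inf.absorb2)
  then show ?thesis
    by unfold_locales (auto simp: sup_plus inf_star plus_least star_greatest)
qed

text \<open>\<open>kappa_d\<close> is literally \<open>kappa\<close> of the dual algebra, so this is
  \<open>le_kappa_iff\<close> read in the reversed order.\<close>

lemma kappa_d_le_iff: "kappa_d inf sup star plus x y \<sqsubseteq> z \<longleftrightarrow> y \<sqsubseteq> x \<squnion> z"
proof -
  have "kappa_d inf sup star plus = kappa sup inf plus star"
    by (simp add: fun_eq_iff kappa_d_def kappa_def)
  then show ?thesis
    using regular_double_p_algebra.le_kappa_iff[OF dual_regular_double_p_algebra] by simp
qed

end

context heyting_algebra
begin

lemma le_imp_iff: "z \<sqsubseteq> x \<rightarrow> y \<longleftrightarrow> x \<sqinter> z \<sqsubseteq> y"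
  by (meson imp_greatest inf_imp inf_mono order_refl order.trans)

lemma p_algebra_imp_bot: "p_algebra inf less_eq less sup bot top (\<lambda>x. x \<rightarrow> \<bottom>)"
  by unfold_locales (auto simp: le_imp_iff bot_unique intro: order.antisym[OF inf_imp bot_least])

text \<open>Both sides are the greatest \<open>z\<close> with
  \<open>x \<sqinter> z \<sqsubseteq> y\<close>. Keeping \<open>plus\<close> arbitrary lets the
  lemma serve both when it is a basic operation and when it comes from \<open>coimp\<close>.\<close>

lemma imp_eq_kappa:
  fixes star plus
  assumes "regular_double_p_algebra inf less_eq less sup bot top star plus"
  shows "x \<rightarrow> y = kappa inf sup star plus x y"
  using regular_double_p_algebra.le_kappa_iff[OF assms] le_imp_iff
  by (metis order.antisym order_refl)

end

context dual_heyting_algebra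
begin

lemma coimp_le_iff: "x \<leftarrow> y \<sqsubseteq> z \<longleftrightarrow> y \<sqsubseteq> x \<squnion> z"
  by (meson coimp_least sup_coimp sup_mono order_refl order.trans)

lemma dual_p_algebra_coimp_top: "dual_p_algebra inf less_eq less sup bot top (\<lambda>x. x \<leftarrow> \<top>)"
  by unfold_locales (auto simp: coimp_le_iff intro: order.antisym[OF top_greatest sup_coimp])

lemma coimp_eq_kappa_d:
  fixes star plus
  assumes "regular_double_p_algebra inf less_eq less sup bot top star plus"
  shows "x \<leftarrow> y = kappa_d inf sup star plus x y"
  using regular_double_p_algebra.kappa_d_le_iff[OF assms] coimp_le_iff
  by (metis order.antisym order_refl)

end

text \<open>Here and in the next two lemmas, a complement that is not a basic operation is obtained
  from the residual: \<open>imp\<close> into \<open>bot\<close>, or \<open>coimp\<close> applied to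
  \<open>top\<close>.\<close>

lemma (in RDPCH) regular_double_p_algebra:
  "regular_double_p_algebra inf less_eq less sup bot top (\<lambda>x. imp x bot) plus"
  by (intro regular_double_p_algebra.intro regular_double_p_algebra_axioms.intro
      p_algebra_imp_bot dual_p_algebra_axioms regularity)

lemma (in RPCHd) regular_double_p_algebra:
  "regular_double_p_algebra inf less_eq less sup bot top star (\<lambda>x. coimp x top)"
  by (intro regular_double_p_algebra.intro regular_double_p_algebra_axioms.intro
      p_algebra_axioms dual_p_algebra_coimp_top regularity)

lemma (in RDBLH) regular_double_p_algebra:
  "regular_double_p_algebra inf less_eq less sup bot top (\<lambda>x. imp x bot) (\<lambda>x. coimp x top)"
  by (intro regular_double_p_algebra.intro regular_double_p_algebra_axioms.intro
      p_algebra_imp_bot dual_p_algebra_coimp_top regularity)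

theorem theorem2p2:
  fixes inf sup imp coimp :: "'a \<Rightarrow> 'a \<Rightarrow> 'a"
    and less_eq less :: "'a \<Rightarrow> 'a \<Rightarrow> bool"
    and bot top :: 'a
    and star plus :: "'a \<Rightarrow> 'a"
  shows "(RDPCH inf less_eq less sup bot top imp plus \<longrightarrow>
            (\<forall>x y. imp x y = kappa inf sup (\<lambda>u. imp u bot) plus x y)) \<and>
         (RPCHd inf less_eq less sup bot top star coimp \<longrightarrow>
            (\<forall>x y. coimp x y = kappa_d inf sup star (\<lambda>u. coimp u top) x y)) \<and>
         (RDBLH inf less_eq less sup bot top imp coimp \<longrightarrow>
            (\<forall>x y. imp x y = kappa inf sup (\<lambda>u. imp u bot) (\<lambda>u. coimp u top) x y) \<and>
            (\<forall>x y. coimp x y = kappa_d inf sup (\<lambda>u. imp u bot) (\<lambda>u. coimp u top) x y))"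
proof (intro conjI impI allI)
  fix x y
  show "imp x y = kappa inf sup (\<lambda>u. imp u bot) plus x y"
    if "RDPCH inf less_eq less sup bot top imp plus"
  proof -
    interpret RDPCH inf less_eq less sup bot top imp plus by (fact that)
    show ?thesis by (rule imp_eq_kappa[OF regular_double_p_algebra])
  qed
  show "coimp x y = kappa_d inf sup star (\<lambda>u. coimp u top) x y"
    if "RPCHd inf less_eq less sup bot top star coimp"
  proof -
    interpret RPCHd inf less_eq less sup bot top star coimp by (fact that)
    show ?thesis by (rule coimp_eq_kappa_d[OF regular_double_p_algebra])
  qed
  assume "RDBLH inf less_eq less sup bot top imp coimp"
  then interpret RDBLH inf less_eq less sup bot top imp coimp .
  show "imp x y = kappa inf sup (\<lambda>u. imp u bot) (\<lambda>u. coimp u top) x y"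
    by (rule imp_eq_kappa[OF regular_double_p_algebra])
  show "coimp x y = kappa_d inf sup (\<lambda>u. imp u bot) (\<lambda>u. coimp u top) x y"
    by (rule coimp_eq_kappa_d[OF regular_double_p_algebra])
qed

end
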